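(* Let $\mu$ be a finite, positive Borel measure on $[0,1]$, and let $c_0:=\mu(\{0\})$ and $c_1:=\mu(\{1\})$ be its Dirac masses at $0$ and $1$. Assume that $|c_0|+|c_1|>0$. (1) For $1\leq p<\infty$, the only case when $\mathcal{C}^{\mu}$ can be a bounded operator on $\ell^p$ is when $c_1\neq 0=c_0$ and $p=1$. In that case (i.e. $c_1\neq 0=c_0$ and $p=1$), the operator is bounded on $\ell^1$ if and only if $$\int_{(0,1]}\frac1t\,\mathrm{d}\mu(t)=\int_{(0,1)}\frac1t\,\mathrm{d}\mu(t)+c_1$$ is finite; moreover, this expression, when finite, equals the norm of the operator on $\ell^1$. (2) For $p=\infty$, the operator $\mathcal{C}^{\mu}$ is bounded on $\ell^{\infty}$ if and only if $c_0\neq 0=c_1$ and the integral $$\int_{[0,1)}\frac{1}{1-t}\,\mathrm{d}\mu(t)$$ is finite. Moreover, in that case, this integral equals the norm of the operator on $\ell^{\infty}$.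
   Context: For a finite, positive Borel measure $\mu$ on $[0,1]$, the generalized Hilbert matrix $\mathcal{C}^{\mu}=(\mathcal{C}^{\mu}_{n,k})_{n,k\geq 0}$ is defined by $$\mathcal{C}^{\mu}_{n,k}:=\binom{n+k}{k}\int_{[0,1]}(1-t)^n t^k\,\mathrm{d}\mu(t),\qquad n,k=0,1,2,\dots,$$ with the convention $0^0=1$. (Thus a Dirac mass $c_0$ at $0$ contributes $c_0$ to every entry of the column $k=0$, and a Dirac mass $c_1$ at $1$ contributes $c_1$ to every entry of the row $n=0$.) The matrix is viewed as an operator on sequences by $(a_k)_{k=0}^{\infty}\mapsto(b_n)_{n=0}^{\infty}$ with $b_n:=\sum_{k=0}^{\infty}\mathcal{C}^{\mu}_{n,k}a_k$. Here $\ell^p$ is the usual space of (real) sequences indexed by $n\geq 0$ with its usual norm. To say that $\mathcal{C}^{\mu}$ is bounded as an operator on $\ell^p$ means that for every $(a_k)\in\ell^p$ the series defining each $b_n$ converges, $(b_n)\in\ell^p$, and the resulting linear map $\ell^p\to\ell^p$ is bounded. *)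

theory Defs
  imports "HOL-Analysis.Analysis"
begin

definition hilbert_matrix :: "real measure \<Rightarrow> nat \<Rightarrow> nat \<Rightarrow> real" where
  "hilbert_matrix \<mu> n k = real ((n + k) choose k) * (\<integral>t. (1 - t) ^ n * t ^ k \<partial>\<mu>)"

text \<open>The sequence spaces are meant for exponents \<open>1 \<le> p \<le> \<infinity>\<close> only.\<close>

definition lp_space :: "ereal \<Rightarrow> (nat \<Rightarrow> real) set" where
  "lp_space p = (if p = \<infinity> then {a. bounded (range a)}
     else {a. summable (\<lambda>k. \<bar>a k\<bar> powr real_of_ereal p)})"

definition lp_norm :: "ereal \<Rightarrow> (nat \<Rightarrow> real) \<Rightarrow> real" where
  "lp_norm p a = (if p = \<infinity> then (SUP k. \<bar>a k\<bar>)
     else (\<Sum>k. \<bar>a k\<bar> powr real_of_ereal p) powr (1 / real_of_ereal p))"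

definition matrix_op :: "(nat \<Rightarrow> nat \<Rightarrow> real) \<Rightarrow> (nat \<Rightarrow> real) \<Rightarrow> nat \<Rightarrow> real" where
  "matrix_op A a n = (\<Sum>k. A n k * a k)"

text \<open>Convergence of the series defining \<open>matrix_op A a n\<close> is part of the definition;
  linearity of the resulting map is then automatic.\<close>

definition bounded_on_lp :: "ereal \<Rightarrow> (nat \<Rightarrow> nat \<Rightarrow> real) \<Rightarrow> bool" where
  "bounded_on_lp p A \<longleftrightarrow>
     (\<forall>a\<in>lp_space p. (\<forall>n. summable (\<lambda>k. A n k * a k)) \<and> matrix_op A a \<in> lp_space p) \<and>
     (\<exists>B. \<forall>a\<in>lp_space p. lp_norm p (matrix_op A a) \<le> B * lp_norm p a)"

text \<open>Only meaningful under \<open>bounded_on_lp p A\<close>, where the supremum is over a set bounded above.\<close>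

definition lp_op_norm :: "ereal \<Rightarrow> (nat \<Rightarrow> nat \<Rightarrow> real) \<Rightarrow> real" where
  "lp_op_norm p A = (SUP a\<in>{a \<in> lp_space p. lp_norm p a \<le> 1}. lp_norm p (matrix_op A a))"

end

theory Submission
  imports Defs
begin

text \<open>
  The entries of \<open>hilbert_matrix \<mu>\<close> are nonnegative, and up to atoms at the endpoints all its
  columns have the same sum, as have all its rows: the negative binomial series gives
  \<open>(\<Sum>n. (n + k choose k) (1 - t)\<^sup>n t\<^sup>k) = 1 / t\<close> for \<open>0 < t \<le> 1\<close>, so by monotone convergence every
  column sums to the integral of \<open>1 / t\<close>, provided that \<open>0\<close> carries no mass; symmetrically every
  row sums to the integral of \<open>1 / (1 - t)\<close>, provided that \<open>1\<close> carries no mass.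

  A nonnegative matrix with constant column sum \<open>S\<close> is bounded on \<open>\<ell>\<^sup>1\<close> exactly if \<open>S\<close> is finite,
  and \<open>S\<close> is then its norm, attained at the first unit vector. Dually, a nonnegative matrix with
  constant row sum \<open>S\<close> is bounded on \<open>\<ell>\<^sup>\<infinity>\<close> exactly if \<open>S\<close> is finite, and \<open>S\<close> is then its norm,
  attained at the constant sequence \<open>1\<close>. These are \<open>column_sums_l1\<close> and \<open>row_sums_linf\<close>.

  The Dirac masses exclude everything else. Mass at \<open>0\<close> keeps the column \<open>k = 0\<close>, the image of the
  first unit vector, away from zero, which is impossible on \<open>\<ell>\<^sup>p\<close> with \<open>p < \<infinity>\<close>. Mass at \<open>1\<close> keeps
  the row \<open>n = 0\<close> away from zero, so the series defining \<open>b\<^sub>0\<close> diverges for the harmonic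
  sequence, which lies in \<open>\<ell>\<^sup>p\<close> for \<open>1 < p < \<infinity>\<close>, and for the constant sequence \<open>1\<close> in \<open>\<ell>\<^sup>\<infinity>\<close>.
\<close>

section \<open>Nonnegative matrices with constant column or row sums\<close>

lemma bounded_on_lpD:
  assumes "bounded_on_lp p A" "a \<in> lp_space p"
  shows "summable (\<lambda>k. A n k * a k)" and "matrix_op A a \<in> lp_space p"
  using assms by (simp_all add: bounded_on_lp_def)

lemma lp_op_norm_eq_if_attained:
  assumes bound: "\<And>a. a \<in> lp_space p \<Longrightarrow> lp_norm p (matrix_op A a) \<le> s * lp_norm p a"
    and s: "0 \<le> s"
    and e: "e \<in> lp_space p" "lp_norm p e \<le> 1" "lp_norm p (matrix_op A e) = s"
  shows "lp_op_norm p A = s"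
  unfolding lp_op_norm_def
proof (rule cSup_eq_maximum)
  show "s \<in> (\<lambda>a. lp_norm p (matrix_op A a)) ` {a \<in> lp_space p. lp_norm p a \<le> 1}"
    using e by force
next
  fix y assume "y \<in> (\<lambda>a. lp_norm p (matrix_op A a)) ` {a \<in> lp_space p. lp_norm p a \<le> 1}"
  then obtain a where a: "a \<in> lp_space p" "lp_norm p a \<le> 1" "y = lp_norm p (matrix_op A a)"
    by blast
  have "y \<le> s * lp_norm p a" using bound a by simp
  also have "\<dots> \<le> s" using s a(2) by (simp add: mult_left_le)
  finally show "y \<le> s" .
qed

lemma lp_space_1: "lp_space 1 = {a. summable (\<lambda>k. \<bar>a k\<bar>)}"
  by (simp add: lp_space_def)

lemma lp_norm_1: "a \<in> lp_space 1 \<Longrightarrow> lp_norm 1 a = (\<Sum>k. \<bar>a k\<bar>)"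
  by (simp add: lp_norm_def lp_space_1 suminf_nonneg)

lemma unit_sequence_sums: "(\<lambda>k. f k * (if k = 0 then 1 else 0)) sums (f 0 :: real)"
proof -
  have "(\<lambda>k. f k * (if k = 0 then 1 else 0)) = (\<lambda>k. if k = 0 then f k else 0)"
    by auto
  then show ?thesis using sums_single[of 0 f] by simp
qed

lemma unit_sequence_in_lp:
  assumes "p \<noteq> \<infinity>"
  shows "(\<lambda>k. if k = 0 then 1 else 0) \<in> lp_space p"
proof -
  have "(\<lambda>k. \<bar>if k = 0 then 1 else 0 :: real\<bar> powr real_of_ereal p)
      = (\<lambda>k::nat. if k = 0 then 1 else 0)"
    by auto
  then show ?thesis
    using assms sums_summable[OF sums_single[of 0 "\<lambda>_. 1 :: real"]]
    by (simp add: lp_space_def)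
qed

lemma matrix_op_unit_sequence: "matrix_op A (\<lambda>k. if k = 0 then 1 else 0) = (\<lambda>n. A n 0)"
proof
  show "matrix_op A (\<lambda>k. if k = 0 then 1 else 0) n = A n 0" for n
    unfolding matrix_op_def by (rule sums_unique[OF unit_sequence_sums, symmetric])
qed

lemma suminf_ennreal_commute:
  fixes f :: "nat \<Rightarrow> nat \<Rightarrow> ennreal"
  shows "(\<Sum>i. \<Sum>j. f i j) = (\<Sum>j. \<Sum>i. f i j)"
  using nn_integral_suminf[of f "count_space UNIV"] by (simp add: nn_integral_count_space_nat)

text \<open>
  The column \<open>k = 0\<close> is the image of a unit vector, which bounds the norm below by \<open>S\<close>. The upper
  bound is the triangle inequality, followed by exchanging the two sums and summing each column.
\<close>
lemma column_sums_l1: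
  fixes A :: "nat \<Rightarrow> nat \<Rightarrow> real"
  assumes nonneg: "\<And>n k. 0 \<le> A n k"
    and cols: "\<And>k. (\<Sum>n. ennreal (A n k)) = S"
  shows "bounded_on_lp 1 A \<longleftrightarrow> S < \<infinity>"
    and "S < \<infinity> \<Longrightarrow> S = ennreal (lp_op_norm 1 A)"
proof -
  let ?e = "\<lambda>k::nat. if k = 0 then 1 else 0 :: real"
  have e: "?e \<in> lp_space 1" by (rule unit_sequence_in_lp) simp
  have Ae: "matrix_op A ?e = (\<lambda>n. A n 0)" by (rule matrix_op_unit_sequence)
  have necessary: "S < \<infinity>" if "bounded_on_lp 1 A"
  proof -
    have "matrix_op A ?e \<in> lp_space 1" by (rule bounded_on_lpD(2)[OF that e])
    then have "summable (\<lambda>n. A n 0)" by (simp add: Ae lp_space_1 nonneg)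
    then show ?thesis using ennreal_suminf_neq_top[of "\<lambda>n. A n 0"] nonneg cols[of 0]
      by (simp add: top.not_eq_extremum)
  qed
  have sufficient: "bounded_on_lp 1 A \<and> S = ennreal (lp_op_norm 1 A)" if "S < \<infinity>"
  proof -
    obtain s where s: "S = ennreal s" "0 \<le> s" using \<open>S < \<infinity>\<close> by (cases S) auto
    have col_summable: "summable (\<lambda>n. A n k)" for k
      using cols[of k] \<open>S < \<infinity>\<close> nonneg by (intro summable_suminf_not_top) auto
    have col_suminf: "(\<Sum>n. A n k) = s" for k
    proof -
      have "ennreal (\<Sum>n. A n k) = ennreal s"
        using suminf_ennreal2[of "\<lambda>n. A n k"] cols[of k] nonneg col_summable s by simp
      then show ?thesis using s by (simp add: suminf_nonneg[OF col_summable nonneg])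
    qed
    \<comment> \<open>Bounded rows make the series defining the image converge on \<open>\<ell>\<^sup>1\<close>.\<close>
    have entry_le: "A n k \<le> s" for n k
      using sum_le_suminf[OF col_summable[of k], of "{n}"] nonneg col_suminf[of k] by auto
    have row_summable_abs: "summable (\<lambda>k. A n k * \<bar>a k\<bar>)" if "a \<in> lp_space 1" for a n
    proof (rule summable_comparison_test'[where N = 0])
      show "summable (\<lambda>k. s * \<bar>a k\<bar>)" using that by (simp add: lp_space_1 summable_mult)
      show "norm (A n k * \<bar>a k\<bar>) \<le> s * \<bar>a k\<bar>" for k
        using nonneg[of n k] entry_le[of n k] by (simp add: abs_mult mult_right_mono)
    qed
    have row_summable: "summable (\<lambda>k. A n k * a k)" if "a \<in> lp_space 1" for a n
      using row_summable_abs[OF that, of n] nonneg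
      by (intro summable_rabs_cancel[of "\<lambda>k. A n k * a k"]) (simp add: abs_mult)
    have image_abs: "(\<Sum>n. ennreal \<bar>matrix_op A a n\<bar>) \<le> ennreal (s * lp_norm 1 a)"
      if a: "a \<in> lp_space 1" for a
    proof -
      have entry: "ennreal \<bar>matrix_op A a n\<bar> \<le> (\<Sum>k. ennreal (A n k) * ennreal \<bar>a k\<bar>)" for n
      proof -
        have "\<bar>matrix_op A a n\<bar> \<le> (\<Sum>k. A n k * \<bar>a k\<bar>)"
          using summable_rabs[of "\<lambda>k. A n k * a k"] row_summable_abs[OF a, of n] nonneg
          by (simp add: matrix_op_def abs_mult)
        then have "ennreal \<bar>matrix_op A a n\<bar> \<le> ennreal (\<Sum>k. A n k * \<bar>a k\<bar>)"
          by (rule ennreal_leI)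
        also have "\<dots> = (\<Sum>k. ennreal (A n k * \<bar>a k\<bar>))"
          by (rule suminf_ennreal2[symmetric]) (simp_all add: nonneg row_summable_abs[OF a])
        also have "\<dots> = (\<Sum>k. ennreal (A n k) * ennreal \<bar>a k\<bar>)"
          by (simp add: nonneg ennreal_mult)
        finally show ?thesis .
      qed
      have "(\<Sum>n. ennreal \<bar>matrix_op A a n\<bar>) \<le> (\<Sum>n. \<Sum>k. ennreal (A n k) * ennreal \<bar>a k\<bar>)"
        by (intro suminf_le entry) auto
      also have "\<dots> = (\<Sum>k. \<Sum>n. ennreal (A n k) * ennreal \<bar>a k\<bar>)"
        by (rule suminf_ennreal_commute)
      also have "\<dots> = S * (\<Sum>k. ennreal \<bar>a k\<bar>)" by (simp add: cols)
      also have "\<dots> = ennreal (s * lp_norm 1 a)"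
        using a s by (simp add: lp_norm_1 suminf_ennreal2 lp_space_1 ennreal_mult suminf_nonneg)
      finally show ?thesis .
    qed
    have image: "matrix_op A a \<in> lp_space 1" if "a \<in> lp_space 1" for a
    proof -
      have "(\<Sum>n. ennreal \<bar>matrix_op A a n\<bar>) \<noteq> top"
        using image_abs[OF that] ennreal_neq_top neq_top_trans by blast
      then show ?thesis unfolding lp_space_1 by (auto intro: summable_suminf_not_top)
    qed
    have bound: "lp_norm 1 (matrix_op A a) \<le> s * lp_norm 1 a" if a: "a \<in> lp_space 1" for a
    proof -
      have "0 \<le> lp_norm 1 a" using a by (simp add: lp_norm_1 suminf_nonneg lp_space_1)
      then have "0 \<le> s * lp_norm 1 a" using s by simp
      moreover have "ennreal (lp_norm 1 (matrix_op A a)) = (\<Sum>n. ennreal \<bar>matrix_op A a n\<bar>)"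
        using image[OF a] by (simp add: lp_norm_1 suminf_ennreal2 lp_space_1)
      ultimately show ?thesis using image_abs[OF a] by (metis ennreal_le_iff)
    qed
    have "bounded_on_lp 1 A"
      unfolding bounded_on_lp_def
      by (intro conjI ballI allI exI[of _ s] row_summable image bound)
    moreover have "lp_op_norm 1 A = s"
    proof (rule lp_op_norm_eq_if_attained[OF bound s(2) e])
      show "lp_norm 1 ?e \<le> 1"
        using sums_unique[OF sums_single[of 0 "\<lambda>_. 1 :: real"]] e
        by (simp add: lp_norm_1 if_distrib[of abs] cong: if_cong)
      show "lp_norm 1 (matrix_op A ?e) = s"
        using lp_norm_1[OF image[OF e]] nonneg col_suminf by (simp add: Ae)
    qed
    ultimately show ?thesis using s by simp
  qed
  show "bounded_on_lp 1 A \<longleftrightarrow> S < \<infinity>" using necessary sufficient by blast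
  show "S < \<infinity> \<Longrightarrow> S = ennreal (lp_op_norm 1 A)" using sufficient by blast
qed

lemma abs_le_lp_norm_inf:
  assumes "a \<in> lp_space \<infinity>"
  shows "\<bar>a k\<bar> \<le> lp_norm \<infinity> a"
proof -
  from assms have "bounded (range a)" by (simp add: lp_space_def)
  then obtain B where "\<And>k. \<bar>a k\<bar> \<le> B" unfolding bounded_iff by auto
  then have "bdd_above (range (\<lambda>k. \<bar>a k\<bar>))" by (intro bdd_aboveI[of _ B]) auto
  then show ?thesis using cSUP_upper[of k UNIV "\<lambda>k. \<bar>a k\<bar>"] by (simp add: lp_norm_def)
qed

lemma lp_inf_bound:
  assumes "\<And>k. \<bar>a k\<bar> \<le> B"
  shows "a \<in> lp_space \<infinity>" and "lp_norm \<infinity> a \<le> B"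
proof -
  show "a \<in> lp_space \<infinity>" using assms unfolding lp_space_def by (auto simp: bounded_iff)
  show "lp_norm \<infinity> a \<le> B" unfolding lp_norm_def using assms by (auto intro: cSUP_least)
qed

lemma one_in_linf: "(\<lambda>_. 1) \<in> lp_space \<infinity>"
  by (rule lp_inf_bound(1)[where B = 1]) simp

text \<open>
  The sum of row \<open>n\<close> is the entry \<open>n\<close> of the image of the constant sequence \<open>1\<close>, which has norm \<open>1\<close>;
  for any other sequence \<open>a\<close> the entry is at most the row sum times the supremum of \<open>a\<close>.
\<close>
lemma row_sums_linf:
  fixes A :: "nat \<Rightarrow> nat \<Rightarrow> real"
  assumes nonneg: "\<And>n k. 0 \<le> A n k"
    and rows: "\<And>n. (\<Sum>k. ennreal (A n k)) = S"
  shows "bounded_on_lp \<infinity> A \<longleftrightarrow> S < \<infinity>"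
    and "S < \<infinity> \<Longrightarrow> S = ennreal (lp_op_norm \<infinity> A)"
proof -
  have necessary: "S < \<infinity>" if "bounded_on_lp \<infinity> A"
  proof -
    have "summable (\<lambda>k. A 0 k)"
      using bounded_on_lpD(1)[OF that one_in_linf, of 0] by simp
    then show ?thesis using ennreal_suminf_neq_top[of "\<lambda>k. A 0 k"] nonneg rows[of 0]
      by (simp add: top.not_eq_extremum)
  qed
  have sufficient: "bounded_on_lp \<infinity> A \<and> S = ennreal (lp_op_norm \<infinity> A)" if "S < \<infinity>"
  proof -
    obtain s where s: "S = ennreal s" "0 \<le> s" using \<open>S < \<infinity>\<close> by (cases S) auto
    have row_summable: "summable (\<lambda>k. A n k)" for n
      using rows[of n] \<open>S < \<infinity>\<close> nonneg by (intro summable_suminf_not_top) auto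
    have row_suminf: "(\<Sum>k. A n k) = s" for n
    proof -
      have "ennreal (\<Sum>k. A n k) = ennreal s"
        using suminf_ennreal2[of "\<lambda>k. A n k"] rows[of n] nonneg row_summable s by simp
      then show ?thesis using s by (simp add: suminf_nonneg[OF row_summable nonneg])
    qed
    have dominated: "\<bar>A n k * a k\<bar> \<le> A n k * lp_norm \<infinity> a" if "a \<in> lp_space \<infinity>" for a n k
      using abs_le_lp_norm_inf[OF that] nonneg by (simp add: abs_mult mult_left_mono)
    have image_summable: "summable (\<lambda>k. \<bar>A n k * a k\<bar>)" if "a \<in> lp_space \<infinity>" for a n
    proof (rule summable_comparison_test'[where N = 0])
      show "summable (\<lambda>k. A n k * lp_norm \<infinity> a)" by (rule summable_mult2[OF row_summable])
      show "norm \<bar>A n k * a k\<bar> \<le> A n k * lp_norm \<infinity> a" for k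
        using dominated[OF that] by simp
    qed
    have entry: "\<bar>matrix_op A a n\<bar> \<le> s * lp_norm \<infinity> a" if a: "a \<in> lp_space \<infinity>" for a n
    proof -
      have "\<bar>matrix_op A a n\<bar> \<le> (\<Sum>k. \<bar>A n k * a k\<bar>)"
        unfolding matrix_op_def by (rule summable_rabs[OF image_summable[OF a]])
      also have "\<dots> \<le> (\<Sum>k. A n k * lp_norm \<infinity> a)"
        by (intro suminf_le dominated a image_summable summable_mult2 row_summable)
      also have "\<dots> = s * lp_norm \<infinity> a"
        by (simp add: row_suminf suminf_mult2[OF row_summable, symmetric])
      finally show ?thesis .
    qed
    have bound: "lp_norm \<infinity> (matrix_op A a) \<le> s * lp_norm \<infinity> a" if "a \<in> lp_space \<infinity>" for a
      using entry[OF that] by (rule lp_inf_bound(2))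
    have "bounded_on_lp \<infinity> A"
      unfolding bounded_on_lp_def
      by (intro conjI ballI allI exI[of _ s] bound lp_inf_bound(1)[OF entry]
          summable_rabs_cancel[OF image_summable])
    moreover have "lp_op_norm \<infinity> A = s"
      using bound s(2) one_in_linf
    proof (rule lp_op_norm_eq_if_attained)
      show "lp_norm \<infinity> (\<lambda>_. 1) \<le> 1" by (rule lp_inf_bound(2)) simp
      show "lp_norm \<infinity> (matrix_op A (\<lambda>_. 1)) = s"
        using s by (simp add: lp_norm_def matrix_op_def row_suminf)
    qed
    ultimately show ?thesis using s by simp
  qed
  show "bounded_on_lp \<infinity> A \<longleftrightarrow> S < \<infinity>" using necessary sufficient by blast
  show "S < \<infinity> \<Longrightarrow> S = ennreal (lp_op_norm \<infinity> A)" using sufficient by blast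
qed

section \<open>Row and column sums of generalized Hilbert matrices\<close>

text \<open>
  Since \<open>(- (n + 1) gchoose k) (- 1)\<^sup>k = (n + k choose k)\<close>, this is the binomial series of
  \<open>(1 - x) powr (- (n + 1))\<close>.
\<close>
lemma negative_binomial_sums:
  fixes x :: real
  assumes "0 \<le> x" "x < 1"
  shows "(\<lambda>k. real ((n + k) choose k) * ((1 - x) ^ n * x ^ k)) sums (1 / (1 - x))"
proof -
  have "((- real (Suc n)) gchoose k) * (- x) ^ k = real ((n + k) choose k) * x ^ k" for k
  proof -
    have "real (Suc n) + real k - 1 = real (n + k)" by simp
    then have "((- real (Suc n)) gchoose k) = (- 1) ^ k * real ((n + k) choose k)"
      by (simp only: gbinomial_minus binomial_gbinomial)
    then show ?thesis by (simp add: mult_ac flip: power_mult_distrib)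
  qed
  then have "(\<lambda>k. real ((n + k) choose k) * x ^ k) sums (1 - x) powr - real (Suc n)"
    using gen_binomial_real[of "- x" "- real (Suc n)"] assms by simp
  then have "(\<lambda>k. (1 - x) ^ n * (real ((n + k) choose k) * x ^ k)) sums
      ((1 - x) ^ n * (1 - x) powr - real (Suc n))"
    by (rule sums_mult)
  moreover have "(1 - x) ^ n * (1 - x) powr - real (Suc n) = 1 / (1 - x)"
  proof -
    have "(1 - x) powr - real (Suc n) = inverse ((1 - x) ^ Suc n)"
      using assms by (simp add: powr_minus powr_realpow del: of_nat_Suc power_Suc)
    then show ?thesis using assms by (simp add: field_simps)
  qed
  ultimately show ?thesis by (simp add: mult_ac)
qed

locale finite_unit_interval_measure = finite_measure \<mu> for \<mu> :: "real measure" +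
  assumes sets_eq: "sets \<mu> = sets (restrict_space borel {0..1})"
begin

lemma space_eq: "space \<mu> = {0..1}"
  using sets_eq_imp_space_eq[OF sets_eq] by (simp add: space_restrict_space)

lemma borel_measurable_from_borel [measurable (raw)]:
  "f \<in> borel_measurable borel \<Longrightarrow> f \<in> borel_measurable \<mu>"
  by (simp add: measurable_cong_sets[OF sets_eq refl] measurable_restrict_space1)

lemma borel_subset_in_sets: "A \<in> sets borel \<Longrightarrow> A \<subseteq> {0..1} \<Longrightarrow> A \<in> sets \<mu>"
  by (auto simp: sets_eq sets_restrict_space)

lemma kernel_nonneg: "t \<in> space \<mu> \<Longrightarrow> 0 \<le> (1 - t) ^ n * t ^ k"
  by (simp add: space_eq)

lemma kernel_integrable: "integrable \<mu> (\<lambda>t. (1 - t) ^ n * t ^ k)"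
proof (rule integrable_const_bound[where B = 1])
  show "AE t in \<mu>. norm ((1 - t) ^ n * t ^ k) \<le> 1"
  proof (rule AE_I2)
    fix t assume "t \<in> space \<mu>"
    then have "0 \<le> t" "t \<le> 1" by (auto simp: space_eq)
    then show "norm ((1 - t) ^ n * t ^ k) \<le> 1"
      by (simp add: mult_le_one power_le_one)
  qed
qed simp

lemma hilbert_matrix_nonneg: "0 \<le> hilbert_matrix \<mu> n k"
  unfolding hilbert_matrix_def
  by (intro mult_nonneg_nonneg integral_nonneg_AE AE_I2 kernel_nonneg) auto

lemma ennreal_hilbert_matrix:
  "ennreal (hilbert_matrix \<mu> n k)
     = (\<integral>\<^sup>+t. ennreal (real ((n + k) choose k) * ((1 - t) ^ n * t ^ k)) \<partial>\<mu>)"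
  unfolding hilbert_matrix_def
  by (subst nn_integral_eq_integral)
     (auto intro!: AE_I2 mult_nonneg_nonneg kernel_nonneg integrable_mult_right kernel_integrable)

lemma atom_le_integral:
  assumes "x \<in> {0..1}" "integrable \<mu> f" "\<And>t. t \<in> space \<mu> \<Longrightarrow> 0 \<le> f t" "f x = 1"
  shows "measure \<mu> {x} \<le> (\<integral>t. f t \<partial>\<mu>)"
proof -
  have x: "{x} \<in> sets \<mu>" using assms(1) by (intro borel_subset_in_sets) auto
  have "measure \<mu> {x} = (\<integral>t. indicator {x} t \<partial>\<mu>)" using x by simp
  also have "\<dots> \<le> (\<integral>t. f t \<partial>\<mu>)"
  proof (rule integral_mono)
    show "integrable \<mu> (indicator {x} :: real \<Rightarrow> real)"
      using x by (simp add: integrable_real_indicator less_top[symmetric])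
    show "indicator {x} t \<le> f t" if "t \<in> space \<mu>" for t
      using assms that by (simp add: indicator_def)
  qed (rule assms)
  finally show ?thesis .
qed

lemma first_column_ge: "measure \<mu> {0} \<le> hilbert_matrix \<mu> n 0"
  using atom_le_integral[OF _ kernel_integrable[of n 0] kernel_nonneg, of 0]
  by (simp add: hilbert_matrix_def)

lemma first_row_ge: "measure \<mu> {1} \<le> hilbert_matrix \<mu> 0 k"
  using atom_le_integral[OF _ kernel_integrable[of 0 k] kernel_nonneg, of 1]
  by (simp add: hilbert_matrix_def)

lemma AE_neq_if_null_atom:
  assumes "x \<in> {0..1}" "measure \<mu> {x} = 0"
  shows "AE t in \<mu>. t \<noteq> x"
proof (rule AE_I')
  show "{x} \<in> null_sets \<mu>"
    using assms by (intro null_setsI borel_subset_in_sets) (auto simp: emeasure_eq_measure)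
qed auto

text \<open>
  Monotone convergence moves the sum inside the integral. At \<open>t = 1\<close> the series diverges for \<open>n = 0\<close>
  and vanishes for \<open>n > 0\<close>, so mass at \<open>1\<close> would contribute to the row \<open>n = 0\<close> only.
\<close>
lemma row_sum:
  assumes "measure \<mu> {1} = 0"
  shows "(\<Sum>k. ennreal (hilbert_matrix \<mu> n k)) = (\<integral>\<^sup>+t\<in>{0..<1}. ennreal (1 / (1 - t)) \<partial>\<mu>)"
proof -
  have "(\<Sum>k. ennreal (hilbert_matrix \<mu> n k))
      = (\<integral>\<^sup>+t. (\<Sum>k. ennreal (real ((n + k) choose k) * ((1 - t) ^ n * t ^ k))) \<partial>\<mu>)"
    unfolding ennreal_hilbert_matrix by (rule nn_integral_suminf[symmetric]) simp
  also have "\<dots> = (\<integral>\<^sup>+t\<in>{0..<1}. ennreal (1 / (1 - t)) \<partial>\<mu>)"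
  proof (rule nn_integral_cong_AE)
    show "AE t in \<mu>. (\<Sum>k. ennreal (real ((n + k) choose k) * ((1 - t) ^ n * t ^ k)))
        = ennreal (1 / (1 - t)) * indicator {0..<1} t"
      using AE_neq_if_null_atom[OF _ assms, simplified] AE_space
    proof eventually_elim
      case (elim t)
      then have "0 \<le> t" "t < 1" by (auto simp: space_eq)
      then show ?case
        by (subst suminf_ennreal_eq[OF _ negative_binomial_sums]) auto
    qed
  qed
  finally show ?thesis .
qed

text \<open>
  The reflection \<open>t \<mapsto> 1 - t\<close> exchanges rows and columns of the kernel, so the series is the one of
  \<open>row_sum\<close> at \<open>1 - t\<close>; mass at \<open>0\<close> would contribute to the column \<open>k = 0\<close> only.
\<close>
lemma column_sum:
  assumes "measure \<mu> {0} = 0"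
  shows "(\<Sum>n. ennreal (hilbert_matrix \<mu> n k)) = (\<integral>\<^sup>+t\<in>{0<..1}. ennreal (1 / t) \<partial>\<mu>)"
proof -
  have "(\<Sum>n. ennreal (hilbert_matrix \<mu> n k))
      = (\<integral>\<^sup>+t. (\<Sum>n. ennreal (real ((n + k) choose k) * ((1 - t) ^ n * t ^ k))) \<partial>\<mu>)"
    unfolding ennreal_hilbert_matrix by (rule nn_integral_suminf[symmetric]) simp
  also have "\<dots> = (\<integral>\<^sup>+t\<in>{0<..1}. ennreal (1 / t) \<partial>\<mu>)"
  proof (rule nn_integral_cong_AE)
    show "AE t in \<mu>. (\<Sum>n. ennreal (real ((n + k) choose k) * ((1 - t) ^ n * t ^ k)))
        = ennreal (1 / t) * indicator {0<..1} t"
      using AE_neq_if_null_atom[OF _ assms, simplified] AE_space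
    proof eventually_elim
      case (elim t)
      then have t: "0 < t" "t \<le> 1" by (auto simp: space_eq)
      have "(n + k) choose k = (k + n) choose n" for n
        using binomial_symmetric[of k "n + k"] by (simp add: add.commute)
      then have "(\<lambda>n. real ((n + k) choose k) * ((1 - t) ^ n * t ^ k)) sums (1 / t)"
        using negative_binomial_sums[of "1 - t" k] t by (simp add: mult_ac)
      then show ?case
        using t by (subst suminf_ennreal_eq) auto
    qed
  qed
  finally show ?thesis .
qed

section \<open>Obstructions from the Dirac masses\<close>

text \<open>
  The image of the first unit vector is the column \<open>k = 0\<close>, whose entries would have to tend to zero
  but are all at least \<open>\<mu> {0}\<close>.
\<close>
lemma atom_at_0_obstructs_lp:
  assumes "p \<noteq> \<infinity>" "1 \<le> p" and bounded: "bounded_on_lp p (hilbert_matrix \<mu>)"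
  shows "measure \<mu> {0} = 0"
proof -
  let ?p = "real_of_ereal p"
  have p: "0 < ?p" using assms(1,2) by (cases p) auto
  have "(\<lambda>n. hilbert_matrix \<mu> n 0) \<in> lp_space p"
    using bounded_on_lpD(2)[OF bounded unit_sequence_in_lp[OF \<open>p \<noteq> \<infinity>\<close>]]
    by (simp add: matrix_op_unit_sequence)
  then have "summable (\<lambda>n. hilbert_matrix \<mu> n 0 powr ?p)"
    using \<open>p \<noteq> \<infinity>\<close> by (simp add: lp_space_def hilbert_matrix_nonneg)
  then have "(\<lambda>n. hilbert_matrix \<mu> n 0 powr ?p) \<longlonglongrightarrow> 0" by (rule summable_LIMSEQ_zero)
  moreover have "measure \<mu> {0} powr ?p \<le> hilbert_matrix \<mu> n 0 powr ?p" for n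
    using p by (intro powr_mono2 first_column_ge) auto
  ultimately have "measure \<mu> {0} powr ?p \<le> 0"
    by (intro LIMSEQ_le_const) auto
  then show ?thesis by simp
qed

text \<open>
  Applied to the constant sequence \<open>1\<close>, the series in the row \<open>n = 0\<close> has terms at least \<open>\<mu> {1}\<close>.
\<close>
lemma atom_at_1_obstructs_linf:
  assumes "bounded_on_lp \<infinity> (hilbert_matrix \<mu>)"
  shows "measure \<mu> {1} = 0"
proof -
  have "(\<lambda>k. hilbert_matrix \<mu> 0 k) \<longlonglongrightarrow> 0"
    using summable_LIMSEQ_zero[OF bounded_on_lpD(1)[OF assms one_in_linf, of 0]] by simp
  then have "measure \<mu> {1} \<le> 0" using first_row_ge by (intro LIMSEQ_le_const) auto
  then show ?thesis by (simp add: measure_le_0_iff)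
qed

text \<open>
  The harmonic sequence lies in \<open>\<ell>\<^sup>p\<close> exactly for \<open>p > 1\<close>. Applied to it, the series in the row
  \<open>n = 0\<close> dominates \<open>\<mu> {1}\<close> times the harmonic series.
\<close>
lemma atom_at_1_obstructs_lp:
  assumes "p \<noteq> \<infinity>" "1 < p" and bounded: "bounded_on_lp p (hilbert_matrix \<mu>)"
  shows "measure \<mu> {1} = 0"
proof (rule ccontr)
  assume nz: "measure \<mu> {1} \<noteq> 0"
  let ?p = "real_of_ereal p" and ?a = "\<lambda>k. inverse (real (Suc k))"
  have p: "1 < ?p" using assms(1,2) by (cases p) auto
  have "summable (\<lambda>k. real (Suc k) powr - ?p)"
    using p by (subst summable_Suc_iff) (simp add: summable_real_powr_iff)
  moreover have "\<bar>?a k\<bar> powr ?p = real (Suc k) powr - ?p" for k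
    by (simp add: powr_minus inverse_powr del: of_nat_Suc)
  ultimately have "?a \<in> lp_space p" using \<open>p \<noteq> \<infinity>\<close> by (simp add: lp_space_def)
  then have summ: "summable (\<lambda>k. hilbert_matrix \<mu> 0 k * ?a k)"
    by (rule bounded_on_lpD(1)[OF bounded])
  have "summable (\<lambda>k. measure \<mu> {1} * ?a k)"
    by (rule summable_comparison_test'[OF summ, where N = 0])
       (auto simp: abs_mult intro!: mult_right_mono first_row_ge)
  then have "summable ?a" using nz by (simp add: summable_cmult_iff)
  then show False
    using not_summable_harmonic[where 'a = real] summable_Suc_iff[of "\<lambda>n. inverse (real n)"]
    by simp
qed

end

theorem theorem2p2:
  fixes \<mu> :: "real measure" and c0 c1 :: real
  assumes "finite_measure \<mu>"
    and "sets \<mu> = sets (restrict_space borel {0..1})"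
    and "c0 = measure \<mu> {0}" and "c1 = measure \<mu> {1}"
    and "\<bar>c0\<bar> + \<bar>c1\<bar> > 0"
  shows
    "(\<forall>p::ereal. 1 \<le> p \<and> p < \<infinity> \<and> bounded_on_lp p (hilbert_matrix \<mu>)
        \<longrightarrow> c1 \<noteq> 0 \<and> c0 = 0 \<and> p = 1)
     \<and> (c1 \<noteq> 0 \<and> c0 = 0 \<longrightarrow>
          (\<integral>\<^sup>+t\<in>{0<..1}. ennreal (1 / t) \<partial>\<mu>)
             = (\<integral>\<^sup>+t\<in>{0<..<1}. ennreal (1 / t) \<partial>\<mu>) + ennreal c1
          \<and> (bounded_on_lp 1 (hilbert_matrix \<mu>)
               \<longleftrightarrow> (\<integral>\<^sup>+t\<in>{0<..1}. ennreal (1 / t) \<partial>\<mu>) < \<infinity>)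
          \<and> ((\<integral>\<^sup>+t\<in>{0<..1}. ennreal (1 / t) \<partial>\<mu>) < \<infinity>
               \<longrightarrow> (\<integral>\<^sup>+t\<in>{0<..1}. ennreal (1 / t) \<partial>\<mu>)
                     = ennreal (lp_op_norm 1 (hilbert_matrix \<mu>))))
     \<and> (bounded_on_lp \<infinity> (hilbert_matrix \<mu>)
          \<longleftrightarrow> c0 \<noteq> 0 \<and> c1 = 0 \<and> (\<integral>\<^sup>+t\<in>{0..<1}. ennreal (1 / (1 - t)) \<partial>\<mu>) < \<infinity>)
     \<and> (bounded_on_lp \<infinity> (hilbert_matrix \<mu>)
          \<longrightarrow> (\<integral>\<^sup>+t\<in>{0..<1}. ennreal (1 / (1 - t)) \<partial>\<mu>)
                = ennreal (lp_op_norm \<infinity> (hilbert_matrix \<mu>)))"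
proof -
  let ?H = "hilbert_matrix \<mu>"
  let ?I = "\<integral>\<^sup>+t\<in>{0<..1}. ennreal (1 / t) \<partial>\<mu>"
  let ?J = "\<integral>\<^sup>+t\<in>{0..<1}. ennreal (1 / (1 - t)) \<partial>\<mu>"
  interpret finite_unit_interval_measure \<mu>
    using assms(1,2)
    by (simp add: finite_unit_interval_measure_def finite_unit_interval_measure_axioms_def)
  have finite_p: "c1 \<noteq> 0 \<and> c0 = 0 \<and> p = 1"
    if p: "1 \<le> p" "p < \<infinity>" and bounded: "bounded_on_lp p ?H" for p :: ereal
  proof -
    have "c0 = 0" using atom_at_0_obstructs_lp[OF _ p(1) bounded] p(2) assms(3) by auto
    moreover from this have "c1 \<noteq> 0" using assms(5) by auto
    moreover from this have "p = 1"
      using atom_at_1_obstructs_lp[OF _ _ bounded] p assms(4) by (auto simp: order_le_less)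
    ultimately show ?thesis by blast
  qed
  have split: "?I = (\<integral>\<^sup>+t\<in>{0<..<1}. ennreal (1 / t) \<partial>\<mu>) + ennreal c1"
  proof -
    have [measurable]: "{0<..<1} \<in> sets \<mu>" "{1} \<in> sets \<mu>" by (auto intro: borel_subset_in_sets)
    have "?I = (\<integral>\<^sup>+t. ennreal (1 / t) * indicator {0<..<1} t + indicator {1} t \<partial>\<mu>)"
      by (intro nn_integral_cong) (auto split: split_indicator)
    also have "\<dots> = (\<integral>\<^sup>+t\<in>{0<..<1}. ennreal (1 / t) \<partial>\<mu>) + emeasure \<mu> {1}"
      by (subst nn_integral_add) auto
    finally show ?thesis using assms(4) by (simp add: emeasure_eq_measure)
  qed
  have l1: "bounded_on_lp 1 ?H \<longleftrightarrow> ?I < \<infinity>" "?I < \<infinity> \<Longrightarrow> ?I = ennreal (lp_op_norm 1 ?H)"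
    if "c0 = 0"
  proof -
    have "measure \<mu> {0} = 0" using that assms(3) by simp
    note sums = column_sums_l1[of ?H, OF hilbert_matrix_nonneg column_sum[OF this]]
    show "bounded_on_lp 1 ?H \<longleftrightarrow> ?I < \<infinity>" by (rule sums(1))
    show "?I < \<infinity> \<Longrightarrow> ?I = ennreal (lp_op_norm 1 ?H)" by (rule sums(2))
  qed
  have linf: "bounded_on_lp \<infinity> ?H \<longleftrightarrow> ?J < \<infinity>" "?J < \<infinity> \<Longrightarrow> ?J = ennreal (lp_op_norm \<infinity> ?H)"
    if "c1 = 0"
  proof -
    have "measure \<mu> {1} = 0" using that assms(4) by simp
    note sums = row_sums_linf[of ?H, OF hilbert_matrix_nonneg row_sum[OF this]]
    show "bounded_on_lp \<infinity> ?H \<longleftrightarrow> ?J < \<infinity>" by (rule sums(1))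
    show "?J < \<infinity> \<Longrightarrow> ?J = ennreal (lp_op_norm \<infinity> ?H)" by (rule sums(2))
  qed
  have "c1 = 0" if "bounded_on_lp \<infinity> ?H"
    using atom_at_1_obstructs_linf[OF that] assms(4) by simp
  then have linf_iff: "bounded_on_lp \<infinity> ?H \<longleftrightarrow> c0 \<noteq> 0 \<and> c1 = 0 \<and> ?J < \<infinity>"
    and linf_norm: "bounded_on_lp \<infinity> ?H \<longrightarrow> ?J = ennreal (lp_op_norm \<infinity> ?H)"
    using linf assms(5) by auto
  have lp: "\<forall>p::ereal. 1 \<le> p \<and> p < \<infinity> \<and> bounded_on_lp p ?H \<longrightarrow> c1 \<noteq> 0 \<and> c0 = 0 \<and> p = 1"
    by (intro allI impI, elim conjE, rule finite_p)
  have l1_all: "c1 \<noteq> 0 \<and> c0 = 0 \<longrightarrow> ?I = (\<integral>\<^sup>+t\<in>{0<..<1}. ennreal (1 / t) \<partial>\<mu>) + ennreal c1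
      \<and> (bounded_on_lp 1 ?H \<longleftrightarrow> ?I < \<infinity>) \<and> (?I < \<infinity> \<longrightarrow> ?I = ennreal (lp_op_norm 1 ?H))"
    by (intro impI conjI split l1; elim conjE)
  show ?thesis by (intro conjI lp l1_all linf_iff linf_norm)
qed

end
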